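(* Let $\alpha$ be a composition of $n$. Then $$\Psi_\alpha=\frac{z_\alpha}{n!}\sum_{\gamma\succcurlyeq\alpha}\bigl|\{\sigma\in\mathrm{Cons}_\alpha:\widehat{\alpha(\sigma)}=\gamma\}\bigr|\sum_{\eta\succcurlyeq\alpha^c}(-1)^{\ell(\eta)-1}F_{\gamma\vee\eta}.$$
   Context: A composition of $n$ is a sequence of positive integers summing to $n$; $\ell(\cdot)$ is the number of parts. $\mathrm{set}(\alpha)=\{\alpha_1,\alpha_1+\alpha_2,\dots,\alpha_1+\cdots+\alpha_{k-1}\}\subseteq[n-1]$ (a bijection with inverse $\mathrm{comp}$). $\alpha\preccurlyeq\beta$ ($\beta\succcurlyeq\alpha$) iff $\mathrm{set}(\beta)\subseteq\mathrm{set}(\alpha)$, i.e.\ $\beta$ is obtained from $\alpha$ by summing consecutive blocks of parts; $\alpha^{(i)}$ is the block of parts of $\alpha$ summing to $\beta_i$. $\alpha^c=\mathrm{comp}([n-1]\setminus\mathrm{set}(\alpha))$; $\gamma\vee\eta$ is the composition with set $\mathrm{set}(\gamma)\cup\mathrm{set}(\eta)$. $M_\beta=\sum_{i_1<\cdots<i_r}x_{i_1}^{\beta_1}\cdots x_{i_r}^{\beta_r}$, $F_\alpha=\sum_{\beta\preccurlyeq\alpha}M_\beta$. $\pi(\gamma)=\prod_{i=1}^{\ell(\gamma)}(\gamma_1+\cdots+\gamma_i)$, $\pi(\alpha,\beta)=\prod_i\pi(\alpha^{(i)})$; $z_\alpha=\prod_i i^{m_i}m_i!$ with $m_i$ the number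 of parts equal to $i$; $\Psi_\alpha=z_\alpha\sum_{\beta\succcurlyeq\alpha}\frac{1}{\pi(\alpha,\beta)}M_\beta$. Consistency: for $\alpha\preccurlyeq\beta$ and $\sigma\in S_n$ in one-line notation, cut the word into consecutive subwords $\sigma^1,\dots,\sigma^{\ell(\beta)}$ of lengths $\beta_1,\dots$; cut each $\sigma^i$ into consecutive pieces of lengths the parts of $\alpha^{(i)}$, viewed as cycles; $\sigma$ is consistent with $\alpha\preccurlyeq\beta$ if for each $i$ every such cycle has its largest element last and the largest elements of successive cycles of $\sigma^i$ increase left to right. $\mathrm{Cons}_{\alpha\preccurlyeq\beta}$ is the set of such $\sigma$, $\mathrm{Cons}_\alpha=\mathrm{Cons}_{\alpha\preccurlyeq\alpha}$, and $\widehat{\alpha(\sigma)}$ is the coarsest composition $\beta\succcurlyeq\alpha$ with $\sigma\in\mathrm{Cons}_{\alpha\preccurlyeq\beta}$. *)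

theory Defs
  imports
    Complex_Main
    "HOL-Library.Function_Algebras"
    "HOL-Library.Poly_Mapping"
    "HOL-Combinatorics.Multiset_Permutations"
begin

section \<open>Compositions\<close>

text \<open>Compositions are lists of positive integers; part number \<open>i\<close> (counted from 1) is
  list position \<open>i - 1\<close>. The number of parts is \<^const>\<open>length\<close>.\<close>

definition compositions :: "nat \<Rightarrow> nat list set" where
  "compositions n = {\<alpha>. 0 \<notin> set \<alpha> \<and> sum_list \<alpha> = n}"

definition comp_set :: "nat list \<Rightarrow> nat set" where
  "comp_set \<alpha> = {sum_list (take k \<alpha>) | k. 1 \<le> k \<and> k < length \<alpha>}"

definition comp_of_set :: "nat \<Rightarrow> nat set \<Rightarrow> nat list" where
  "comp_of_set n = inv_into (compositions n) comp_set"

text \<open>\<open>\<alpha> \<preceq> \<beta>\<close> means that \<open>\<alpha>\<close> is finer. The two must be compositions of the same number,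
  which \<^const>\<open>comp_set\<close> alone does not see.\<close>

definition refines :: "nat list \<Rightarrow> nat list \<Rightarrow> bool" (infix "\<preceq>" 50) where
  "\<alpha> \<preceq> \<beta> \<longleftrightarrow>
     (\<exists>n. \<alpha> \<in> compositions n \<and> \<beta> \<in> compositions n) \<and> comp_set \<beta> \<subseteq> comp_set \<alpha>"

definition comp_compl :: "nat list \<Rightarrow> nat list" where
  "comp_compl \<alpha> = comp_of_set (sum_list \<alpha>) ({1..sum_list \<alpha> - 1} - comp_set \<alpha>)"

definition comp_join :: "nat list \<Rightarrow> nat list \<Rightarrow> nat list" where
  "comp_join \<gamma> \<eta> = comp_of_set (sum_list \<gamma>) (comp_set \<gamma> \<union> comp_set \<eta>)"

text \<open>For \<open>\<alpha> \<preceq> \<beta>\<close>, the list of blocks of parts of \<open>\<alpha>\<close> summing to the parts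
  of \<open>\<beta>\<close>; it is unique since parts are positive.\<close>

definition comp_blocks :: "nat list \<Rightarrow> nat list \<Rightarrow> nat list list" where
  "comp_blocks \<alpha> \<beta> = (THE A. concat A = \<alpha> \<and> map sum_list A = \<beta>)"

definition pi_comp :: "nat list \<Rightarrow> nat" where
  "pi_comp \<gamma> = (\<Prod>i = 1..length \<gamma>. sum_list (take i \<gamma>))"

definition pi_refine :: "nat list \<Rightarrow> nat list \<Rightarrow> nat" where
  "pi_refine \<alpha> \<beta> = prod_list (map pi_comp (comp_blocks \<alpha> \<beta>))"

definition z_comp :: "nat list \<Rightarrow> nat" where
  "z_comp \<alpha> = (\<Prod>i\<in>set \<alpha>. i ^ count_list \<alpha> i * fact (count_list \<alpha> i))"


section \<open>Quasisymmetric functions\<close>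

text \<open>A formal power series in the variables \<open>x\<^sub>0, x\<^sub>1, \<dots>\<close> is its coefficient function on
  finitely supported exponent vectors. Addition is pointwise; the pointwise product that
  the imported function algebra also provides is not the product of power series and is
  not used.\<close>

type_synonym 'a series = "(nat \<Rightarrow>\<^sub>0 nat) \<Rightarrow> 'a"

definition series_scale :: "'a::field_char_0 \<Rightarrow> 'a series \<Rightarrow> 'a series" (infixr "*\<^sub>s" 75) where
  "c *\<^sub>s f = (\<lambda>m. c * f m)"

text \<open>The exponent vector of \<open>x\<^bsub>i\<^sub>1\<^esub>\<^bsup>\<beta>\<^sub>1\<^esup> \<cdots> x\<^bsub>i\<^sub>r\<^esub>\<^bsup>\<beta>\<^sub>r\<^esup>\<close>.\<close>

definition exponents :: "nat list \<Rightarrow> nat list \<Rightarrow> (nat \<Rightarrow>\<^sub>0 nat)" where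
  "exponents is \<beta> = (\<Sum>j < length \<beta>. Poly_Mapping.single (is ! j) (\<beta> ! j))"

text \<open>The infinite sum of monomials is taken formally: the coefficient of a monomial
  is the number of index sequences \<open>i\<^sub>1 < \<cdots> < i\<^sub>r\<close> that produce it.\<close>

definition M_qsym :: "nat list \<Rightarrow> 'a::field_char_0 series" where
  "M_qsym \<beta> = (\<lambda>m. of_nat (card
     {is. length is = length \<beta> \<and> sorted_wrt (<) is \<and> exponents is \<beta> = m}))"

definition F_qsym :: "nat list \<Rightarrow> 'a::field_char_0 series" where
  "F_qsym \<alpha> = (\<Sum>\<beta> | \<beta> \<preceq> \<alpha>. M_qsym \<beta>)"

definition Psi_qsym :: "nat list \<Rightarrow> 'a::field_char_0 series" where
  "Psi_qsym \<alpha> =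
     of_nat (z_comp \<alpha>) *\<^sub>s (\<Sum>\<beta> | \<alpha> \<preceq> \<beta>. (1 / of_nat (pi_refine \<alpha> \<beta>)) *\<^sub>s M_qsym \<beta>)"


section \<open>Consistent permutations\<close>

text \<open>A permutation of \<open>{1..n}\<close> in one-line notation is an element of
  \<open>permutations_of_set {1..n}\<close>.\<close>

fun cut :: "nat list \<Rightarrow> 'a list \<Rightarrow> 'a list list" where
  "cut [] w = []"
| "cut (k # ks) w = take k w # cut ks (drop k w)"

definition consistent :: "nat list \<Rightarrow> nat list \<Rightarrow> nat list \<Rightarrow> bool" where
  "consistent \<alpha> \<beta> \<sigma> \<longleftrightarrow>
     (\<forall>i < length \<beta>.
        let cycles = cut (comp_blocks \<alpha> \<beta> ! i) (cut \<beta> \<sigma> ! i) in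
          (\<forall>c \<in> set cycles. last c = Max (set c)) \<and>
          sorted_wrt (<) (map (\<lambda>c. Max (set c)) cycles))"

definition Cons_perms :: "nat list \<Rightarrow> nat list \<Rightarrow> nat list set" where
  "Cons_perms \<alpha> \<beta> = {\<sigma> \<in> permutations_of_set {1..sum_list \<alpha>}. consistent \<alpha> \<beta> \<sigma>}"

text \<open>The coarsest \<open>\<beta>\<close> with \<open>\<alpha> \<preceq> \<beta>\<close> and \<open>\<sigma>\<close> consistent with \<open>\<alpha> \<preceq> \<beta>\<close>; it exists for
  \<open>\<sigma> \<in> Cons_perms \<alpha> \<alpha>\<close>.\<close>

definition coarsest :: "nat list \<Rightarrow> nat list \<Rightarrow> nat list" where
  "coarsest \<alpha> \<sigma> = (THE \<beta>. \<alpha> \<preceq> \<beta> \<and> \<sigma> \<in> Cons_perms \<alpha> \<beta> \<and>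
     (\<forall>\<beta>'. \<alpha> \<preceq> \<beta>' \<and> \<sigma> \<in> Cons_perms \<alpha> \<beta>' \<longrightarrow> \<beta>' \<preceq> \<beta>))"

end

theory Submission
  imports Defs
begin

text \<open>Write \<open>A\<close> for the set of \<open>\<alpha>\<close>. Expanding the \<open>F\<close>s into monomial functions, the coefficient of
  \<open>M\<^sub>\<beta>\<close> in the inner sum for \<open>\<gamma>\<close> is an alternating sum over the subsets of the part of
  the set of \<open>\<beta>\<close> outside \<open>A\<close>, so the inner sum collapses to the \<open>M\<^sub>\<beta>\<close> with
  \<open>\<alpha> \<preceq> \<beta> \<preceq> \<gamma>\<close>. A permutation in \<open>Cons\<^sub>\<alpha>\<close> is consistent with \<open>\<alpha> \<preceq> \<beta>\<close> iff the set of
  \<open>\<beta>\<close> contains all partial sums of \<open>\<alpha>\<close> at which the maximum of the cycle drops, that is, iff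
  \<open>\<beta>\<close> refines its coarsest composition. The total coefficient of \<open>M\<^sub>\<beta>\<close> is therefore the number of
  permutations consistent with \<open>\<alpha> \<preceq> \<beta>\<close>, which is \<open>n!\<close> divided by \<open>\<pi>(\<alpha>, \<beta>)\<close>:
  the word of a block is consistent iff it ends in its overall maximum and stays consistent
  after its last cycle is removed, so the cycles can be counted from right to left.\<close>

section \<open>Compositions and their sets of partial sums\<close>

lemma comp_set_Nil [simp]: "comp_set [] = {}"
  by (auto simp: comp_set_def)

lemma comp_set_image: "comp_set xs = (\<lambda>k. sum_list (take k xs)) ` {1..<length xs}"
  unfolding comp_set_def image_def by auto

text \<open>A new last part leaves the earlier partial sums alone, whereas a new first part shifts
  all of them. Most inductions on compositions below therefore run from the right.\<close>

lemma comp_set_snoc: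
  "comp_set (xs @ [x]) = (if xs = [] then {} else insert (sum_list xs) (comp_set xs))"
proof (cases "xs = []")
  case True
  then show ?thesis by (auto simp: comp_set_def)
next
  case False
  have "comp_set (xs @ [x]) = (\<lambda>k. sum_list (take k (xs @ [x]))) ` {1..<length xs + 1}"
    by (simp add: comp_set_image)
  also have "{1..<length xs + 1} = insert (length xs) {1..<length xs}"
    using False by (auto simp: Suc_le_eq)
  also have "(\<lambda>k. sum_list (take k (xs @ [x]))) ` \<dots> =
      insert (sum_list xs) ((\<lambda>k. sum_list (take k xs)) ` {1..<length xs})"
    by (auto simp: image_iff)
  also have "(\<lambda>k. sum_list (take k xs)) ` {1..<length xs} = comp_set xs"
    by (simp add: comp_set_image)
  finally show ?thesis using False by simp
qed

lemma comp_set_Cons: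
  "comp_set (x # xs) = (if xs = [] then {} else insert x ((+) x ` comp_set xs))"
proof (induction xs rule: rev_induct)
  case Nil
  then show ?case using comp_set_snoc[of "[]" x] by simp
next
  case (snoc y ys)
  then show ?case
    using comp_set_snoc[of "x # ys" y] by (auto simp: comp_set_snoc)
qed

lemma sum_list_pos: "0 \<notin> set xs \<Longrightarrow> xs \<noteq> [] \<Longrightarrow> 0 < sum_list (xs :: nat list)"
  by (cases xs) auto

lemma comp_set_bounds:
  assumes "0 \<notin> set xs" "s \<in> comp_set xs"
  shows "0 < s" "s < sum_list xs"
  using assms by (induction xs arbitrary: s rule: rev_induct)
    (auto simp: comp_set_snoc sum_list_pos intro: trans_less_add1 split: if_splits)

lemma finite_comp_set [simp]: "finite (comp_set xs)"
  by (induction xs rule: rev_induct) (auto simp: comp_set_snoc)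

lemma card_comp_set:
  assumes "0 \<notin> set xs"
  shows "card (comp_set xs) = length xs - 1"
  using assms
proof (induction xs rule: rev_induct)
  case (snoc x xs)
  have "sum_list xs \<notin> comp_set xs"
    using comp_set_bounds(2)[of xs "sum_list xs"] snoc.prems by auto
  with snoc show ?case by (auto simp: comp_set_snoc Suc_diff_le)
qed simp

text \<open>The largest proper partial sum is the total of all parts but the last. Reading it off
  and deleting it yields the total and the set of the shorter list, to which the induction
  hypothesis applies; the equal overall sums then fix the last part.\<close>

lemma comp_set_inj:
  assumes "0 \<notin> set xs" "0 \<notin> set ys" "sum_list xs = sum_list ys" "comp_set xs = comp_set ys"
  shows "xs = ys"
  using assms
proof (induction xs arbitrary: ys rule: rev_induct)
  case Nil
  then show ?case by (cases ys) auto
next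
  case (snoc x xs)
  then obtain z zs where ys: "ys = zs @ [z]" by (cases ys rule: rev_cases) auto
  have max: "Max (insert (sum_list us) (comp_set us)) = sum_list us"
    and diff: "insert (sum_list us) (comp_set us) - {sum_list us} = comp_set us"
    if "0 \<notin> set us" for us
    using comp_set_bounds[OF that] by (auto intro!: Max_eqI simp: less_imp_le)
  have pos: "0 \<notin> set xs" "0 \<notin> set zs" using snoc.prems ys by auto
  show ?case
  proof (cases "xs = []")
    case True
    then have "zs = []"
      using snoc.prems(4) ys by (auto simp: comp_set_snoc comp_set_Cons split: if_splits)
    then show ?thesis using True snoc.prems(3) ys by simp
  next
    case False
    then have "zs \<noteq> []" using snoc.prems(4) ys by (auto simp: comp_set_snoc split: if_splits)
    with False have *: "insert (sum_list xs) (comp_set xs) = insert (sum_list zs) (comp_set zs)"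
      using snoc.prems(4) ys by (simp add: comp_set_snoc)
    then have sums: "sum_list xs = sum_list zs" using max[OF pos(1)] max[OF pos(2)] by simp
    moreover have "comp_set xs = comp_set zs" by (metis diff pos * sums)
    ultimately show ?thesis using snoc.IH[OF pos] snoc.prems(3) ys by simp
  qed
qed

text \<open>The maximum \<open>m\<close> of \<open>S\<close> must be the total of all parts but the
  last, so a composition of \<open>m\<close> with set \<open>S - {m}\<close> is extended by the part
  \<open>n - m\<close>.\<close>

lemma comp_set_surj:
  assumes "S \<subseteq> {1..n - 1}"
  shows "\<exists>xs \<in> compositions n. comp_set xs = S"
  using assms
proof (induction n arbitrary: S rule: less_induct)
  case (less n)
  have fin: "finite S" using less.prems finite_subset by blast
  show ?case
  proof (cases "S = {}")
    case True
    show ?thesis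
    proof (cases "n = 0")
      case True
      with \<open>S = {}\<close> show ?thesis by (intro bexI[of _ "[]"]) (auto simp: compositions_def)
    next
      case False
      with \<open>S = {}\<close> show ?thesis
        by (intro bexI[of _ "[n]"]) (auto simp: compositions_def comp_set_Cons)
    qed
  next
    case False
    define m where "m = Max S"
    have m: "m \<in> S" using False fin by (simp add: m_def)
    then have "m \<in> {1..n - 1}" using less.prems by blast
    then have mn: "0 < m" "m < n" by auto
    have "S - {m} \<subseteq> {1..m - 1}"
    proof
      fix s assume s: "s \<in> S - {m}"
      then have "s \<in> {1..n - 1}" "s \<le> m" using fin less.prems by (auto simp: m_def)
      with s have "1 \<le> s" "s \<noteq> m" "s \<le> m" by auto
      then show "s \<in> {1..m - 1}" by auto
    qed
    then obtain xs where xs: "xs \<in> compositions m" "comp_set xs = S - {m}"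
      using less.IH[OF mn(2)] by blast
    then have sum: "sum_list xs = m" by (simp add: compositions_def)
    then have "xs \<noteq> []" using mn by auto
    then have "comp_set (xs @ [n - m]) = S"
      using m xs(2) sum by (simp add: comp_set_snoc insert_absorb)
    moreover have "xs @ [n - m] \<in> compositions n"
      using xs mn by (auto simp: compositions_def)
    ultimately show ?thesis by blast
  qed
qed

lemma bij_betw_comp_set: "bij_betw comp_set (compositions n) (Pow {1..n - 1})"
proof (intro bij_betw_imageI)
  show "inj_on comp_set (compositions n)"
    by (auto simp: inj_on_def compositions_def intro: comp_set_inj)
  show "comp_set ` compositions n = Pow {1..n - 1}"
  proof
    show "comp_set ` compositions n \<subseteq> Pow {1..n - 1}"
    proof clarify
      fix xs s assume "xs \<in> compositions n" "s \<in> comp_set xs"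
      then have "0 < s" "s < n" using comp_set_bounds[of xs s] by (auto simp: compositions_def)
      then show "s \<in> {1..n - 1}" by auto
    qed
    show "Pow {1..n - 1} \<subseteq> comp_set ` compositions n"
      using comp_set_surj by blast
  qed
qed

lemma comp_set_subset: "xs \<in> compositions n \<Longrightarrow> comp_set xs \<subseteq> {1..n - 1}"
  using bij_betw_comp_set[of n] by (auto simp: bij_betw_def)

lemma finite_compositions [simp]: "finite (compositions n)"
  using bij_betw_finite[OF bij_betw_comp_set[of n]] by simp

lemma comp_of_set:
  assumes "S \<subseteq> {1..n - 1}"
  shows "comp_of_set n S \<in> compositions n" "comp_set (comp_of_set n S) = S"
proof -
  have "S \<in> comp_set ` compositions n"
    using assms bij_betw_comp_set[of n] by (auto simp: bij_betw_def)
  then show "comp_of_set n S \<in> compositions n" "comp_set (comp_of_set n S) = S"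
    unfolding comp_of_set_def by (simp_all only: inv_into_into f_inv_into_f)
qed

lemma refines_iff_right:
  assumes "\<alpha> \<in> compositions n"
  shows "\<alpha> \<preceq> \<beta> \<longleftrightarrow> \<beta> \<in> compositions n \<and> comp_set \<beta> \<subseteq> comp_set \<alpha>"
  using assms by (auto simp: refines_def compositions_def)

lemma refines_iff_left:
  assumes "\<beta> \<in> compositions n"
  shows "\<alpha> \<preceq> \<beta> \<longleftrightarrow> \<alpha> \<in> compositions n \<and> comp_set \<beta> \<subseteq> comp_set \<alpha>"
  using assms by (auto simp: refines_def compositions_def)

lemma refines_antisym:
  assumes "\<alpha> \<preceq> \<beta>" "\<beta> \<preceq> \<alpha>"
  shows "\<alpha> = \<beta>"
  using assms by (auto simp: refines_def compositions_def intro: comp_set_inj)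

section \<open>Blocks of a refinement\<close>

text \<open>Of the two first blocks one is a prefix of the other. The surplus \<open>us\<close> has
  sum 0, and since parts are positive it is empty.\<close>

lemma concat_sums_unique:
  assumes "concat A = concat B" "map sum_list A = map sum_list B" "0 \<notin> set (concat A)"
  shows "A = (B :: nat list list)"
  using assms
proof (induction A arbitrary: B)
  case (Cons a A)
  then obtain b B' where B: "B = b # B'" by (cases B) auto
  have eq: "a @ concat A = b @ concat B'" and sums: "sum_list a = sum_list b"
    using Cons.prems B by auto
  have pos: "0 \<notin> set (a @ concat A)" "0 \<notin> set (b @ concat B')"
    using Cons.prems(3) eq by auto
  have "a = b"
    using eq
  proof (subst (asm) append_eq_append_conv2, elim exE disjE conjE)
    fix us assume "a = b @ us" "us @ concat A = concat B'"
    with sums pos show ?thesis by (cases us) auto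
  next
    fix us assume "a @ us = b" "concat A = us @ concat B'"
    with sums pos show ?thesis by (cases us) auto
  qed
  then show ?case using Cons.IH[of B'] Cons.prems B eq by auto
qed simp

text \<open>The total of all parts of the coarser list but the last is a partial sum of \<alpha>,
  say that of its first \<open>k\<close> parts. Then \<open>drop k \<alpha>\<close> is the last
  block, and the induction hypothesis splits \<open>take k \<alpha>\<close>.\<close>

lemma blocks_exist:
  assumes "0 \<notin> set \<alpha>" "0 \<notin> set \<beta>" "sum_list \<alpha> = sum_list \<beta>" "comp_set \<beta> \<subseteq> comp_set \<alpha>"
  shows "\<exists>A. concat A = \<alpha> \<and> map sum_list A = \<beta>"
  using assms
proof (induction \<beta> arbitrary: \<alpha> rule: rev_induct)
  case Nil
  then show ?case by (cases \<alpha>) auto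
next
  case (snoc b \<beta>)
  show ?case
  proof (cases "\<beta> = []")
    case True
    then show ?thesis using snoc.prems by (intro exI[of _ "[\<alpha>]"]) auto
  next
    case False
    then have sub: "insert (sum_list \<beta>) (comp_set \<beta>) \<subseteq> comp_set \<alpha>"
      using snoc.prems(4) by (simp add: comp_set_snoc)
    then have "sum_list \<beta> \<in> comp_set \<alpha>" by blast
    then obtain k where k: "1 \<le> k" "k < length \<alpha>" "sum_list \<beta> = sum_list (take k \<alpha>)"
      by (auto simp: comp_set_def)
    have dec: "sum_list \<alpha> = sum_list (take k \<alpha>) + sum_list (drop k \<alpha>)"
      by (metis append_take_drop_id sum_list_append)
    have "comp_set \<beta> \<subseteq> comp_set (take k \<alpha>)"
    proof
      fix s assume s: "s \<in> comp_set \<beta>"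
      then have less: "s < sum_list \<beta>" using comp_set_bounds snoc.prems(2) by auto
      have "s \<in> comp_set \<alpha>" using s sub by blast
      then obtain j where j: "1 \<le> j" "j < length \<alpha>" "s = sum_list (take j \<alpha>)"
        by (auto simp: comp_set_def)
      \<comment> \<open>A prefix of at least \<open>k\<close> parts would have a sum of at least
        \<open>sum_list \<beta>\<close>, while \<open>s\<close> lies strictly below it.\<close>
      have "j < k"
      proof (rule ccontr)
        assume "\<not> j < k"
        then have "take j \<alpha> = take k \<alpha> @ take (j - k) (drop k \<alpha>)"
          using take_add[of k "j - k" \<alpha>] by simp
        then show False using less j k by simp
      qed
      with j k show "s \<in> comp_set (take k \<alpha>)"
        by (auto simp: comp_set_def intro!: exI[of _ j])
    qed
    moreover have "0 \<notin> set (take k \<alpha>)" using snoc.prems(1) in_set_takeD by fastforce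
    ultimately obtain A where "concat A = take k \<alpha>" "map sum_list A = \<beta>"
      using snoc.IH[of "take k \<alpha>"] snoc.prems(2) k(3) by auto
    then show ?thesis
      using dec k(3) snoc.prems(3) by (intro exI[of _ "A @ [drop k \<alpha>]"]) simp
  qed
qed

lemma comp_blocks:
  assumes "\<alpha> \<preceq> \<beta>"
  shows "concat (comp_blocks \<alpha> \<beta>) = \<alpha>" "map sum_list (comp_blocks \<alpha> \<beta>) = \<beta>"
proof -
  have pos: "0 \<notin> set \<alpha>" using assms by (auto simp: refines_def compositions_def)
  obtain A where A: "concat A = \<alpha> \<and> map sum_list A = \<beta>"
    using assms blocks_exist[of \<alpha> \<beta>] by (auto simp: refines_def compositions_def)
  have "concat (comp_blocks \<alpha> \<beta>) = \<alpha> \<and> map sum_list (comp_blocks \<alpha> \<beta>) = \<beta>"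
    unfolding comp_blocks_def
    by (rule theI[of _ A], rule A) (use A pos concat_sums_unique in force)
  then show "concat (comp_blocks \<alpha> \<beta>) = \<alpha>" "map sum_list (comp_blocks \<alpha> \<beta>) = \<beta>" by auto
qed

section \<open>Cutting words and consistency block by block\<close>

lemma length_cut [simp]: "length (cut ks w) = length ks"
  by (induction ks arbitrary: w) auto

lemma cut_append: "cut (ks @ ls) w = cut ks w @ cut ls (drop (sum_list ks) w)"
  by (induction ks arbitrary: w) (auto simp: add.commute)

lemma cut_take: "sum_list ks \<le> m \<Longrightarrow> cut ks (take m w) = cut ks w"
  by (induction ks arbitrary: w m) (auto simp: drop_take min_def)

definition last_Max :: "'a::linorder list \<Rightarrow> bool" where
  "last_Max c \<longleftrightarrow> last c = Max (set c)"

text \<open>The condition that \<open>consistent\<close> imposes on a single block. The word may be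
  longer than \<open>sum_list ks\<close>; \<open>cut\<close> ignores the surplus letters, so the
  same word can be tested against a shorter list of cycle lengths.\<close>

definition block_consistent :: "nat list \<Rightarrow> 'a::linorder list \<Rightarrow> bool" where
  "block_consistent ks w \<longleftrightarrow>
     (\<forall>c \<in> set (cut ks w). last_Max c) \<and> sorted_wrt (<) (map (\<lambda>c. Max (set c)) (cut ks w))"

text \<open>Consistency in terms of the list of blocks instead of a pair of compositions, so that
  inductions can peel off the first block.\<close>

definition blocks_consistent :: "nat list list \<Rightarrow> 'a::linorder list \<Rightarrow> bool" where
  "blocks_consistent A w \<longleftrightarrow> list_all2 block_consistent A (cut (map sum_list A) w)"

lemma blocks_consistent_Nil [simp]: "blocks_consistent [] w"
  by (simp add: blocks_consistent_def)

lemma block_consistent_take: "block_consistent a (take (sum_list a) w) = block_consistent a w"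
  by (simp add: block_consistent_def cut_take)

lemma blocks_consistent_Cons [simp]:
  "blocks_consistent (a # A) w \<longleftrightarrow>
     block_consistent a w \<and> blocks_consistent A (drop (sum_list a) w)"
  by (simp add: blocks_consistent_def block_consistent_take)

lemma consistent_iff_blocks:
  assumes "\<alpha> \<preceq> \<beta>"
  shows "consistent \<alpha> \<beta> \<sigma> \<longleftrightarrow> blocks_consistent (comp_blocks \<alpha> \<beta>) \<sigma>"
proof -
  have "length (comp_blocks \<alpha> \<beta>) = length \<beta>"
    using comp_blocks(2)[OF assms] by (metis length_map)
  then show ?thesis
    unfolding consistent_def blocks_consistent_def comp_blocks(2)[OF assms]
    by (auto simp: list_all2_conv_all_nth Let_def block_consistent_def last_Max_def)
qed

section \<open>Consistency as a condition on descents of cycle maxima\<close>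

text \<open>\<open>ms\<close> holds one value for each part of the composition; a failure to increase between
  consecutive values is recorded by the partial sum up to the first of the two parts.\<close>

fun descents :: "nat list \<Rightarrow> 'a::linorder list \<Rightarrow> nat set" where
  "descents (a # b # ks) (x # y # ms) =
     (if x < y then {} else {a}) \<union> (+) a ` descents (b # ks) (y # ms)"
| "descents _ _ = {}"

lemma descents_subset: "descents ks ms \<subseteq> comp_set ks"
proof (induction ks ms rule: descents.induct)
  case (1 a b ks x y ms)
  then show ?case using comp_set_Cons[of a "b # ks"] by auto
qed auto

text \<open>\<open>descents\<close> compares neighbours only, \<open>sorted_wrt\<close> all pairs;
  transitivity bridges the gap.\<close>

lemma descents_empty_iff:
  assumes "length ks = length ms"
  shows "descents ks ms = {} \<longleftrightarrow> sorted_wrt (<) ms"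
  using assms
proof (induction ks ms rule: descents.induct)
  case (1 a b ks x y ms)
  then show ?case by (auto intro: less_trans)
qed (auto simp: length_Suc_conv Suc_length_conv)

lemma descents_append:
  assumes "length ks = length ms" "length ls = length ns" "ms \<noteq> []" "ns \<noteq> []"
  shows "descents (ks @ ls) (ms @ ns) =
    descents ks ms \<union> (if last ms < hd ns then {} else {sum_list ks}) \<union>
      (+) (sum_list ks) ` descents ls ns"
proof -
  obtain l ls' n ns' where ls: "ls = l # ls'" "ns = n # ns'"
    using assms by (cases ls; cases ns) auto
  show ?thesis
    using assms(1,3) unfolding ls
  proof (induction ks ms rule: descents.induct)
    case (1 a b ks x y ms)
    then show ?case by (auto simp: image_Un image_image add.assoc)
  qed (auto simp: Suc_length_conv length_Suc_conv)
qed

text \<open>The three sets on the left lie below \<open>s\<close>, at \<open>s\<close> and above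
  \<open>s\<close>, so they can be compared with the right-hand side separately. In the application
  \<open>P\<close> holds the descents inside the first block, \<open>Q\<close> a possible descent at
  its right end, and \<open>E\<close> those of the later blocks.\<close>

lemma shifted_union_subset_iff:
  fixes s :: nat
  assumes "\<And>x. x \<in> P \<Longrightarrow> 0 < x \<and> x < s" "0 \<notin> E" "Q \<subseteq> {s}"
  shows "P \<union> Q \<union> (+) s ` E \<subseteq> insert s ((+) s ` C) \<longleftrightarrow> P = {} \<and> E \<subseteq> C"
proof
  assume sub: "P \<union> Q \<union> (+) s ` E \<subseteq> insert s ((+) s ` C)"
  have "P = {}"
  proof (rule ccontr)
    assume "P \<noteq> {}"
    then obtain x where x: "x \<in> P" by blast
    then have "x \<in> insert s ((+) s ` C)" using sub by blast
    then show False using assms(1)[OF x] by auto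
  qed
  moreover have "x \<in> C" if x: "x \<in> E" for x
  proof -
    have "s + x \<in> insert s ((+) s ` C)" using sub x by blast
    moreover have "x \<noteq> 0" using assms(2) x by metis
    ultimately show ?thesis by auto
  qed
  ultimately show "P = {} \<and> E \<subseteq> C" by blast
qed (use assms(3) in auto)

text \<open>Maxima must increase inside a block but may do anything across a boundary between
  blocks, and the boundaries are exactly the proper partial sums of the block sums.\<close>

lemma blocks_consistent_iff_descents:
  assumes "0 \<notin> set (concat A)" "[] \<notin> set A"
  shows "blocks_consistent A w \<longleftrightarrow>
    (\<forall>c \<in> set (cut (concat A) w). last_Max c) \<and>
    descents (concat A) (map (\<lambda>c. Max (set c)) (cut (concat A) w)) \<subseteq> comp_set (map sum_list A)"
  using assms
proof (induction A arbitrary: w)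
  case (Cons a A)
  let ?M = "map (\<lambda>c. Max (set c))"
  let ?v = "drop (sum_list a) w"
  have a: "a \<noteq> []" "0 \<notin> set a" and pos: "0 < sum_list a"
    using Cons.prems by (auto intro!: sum_list_pos)
  have IH: "blocks_consistent A ?v \<longleftrightarrow> (\<forall>c \<in> set (cut (concat A) ?v). last_Max c) \<and>
      descents (concat A) (?M (cut (concat A) ?v)) \<subseteq> comp_set (map sum_list A)"
    using Cons by simp
  have sorted: "sorted_wrt (<) (?M (cut a w)) \<longleftrightarrow> descents a (?M (cut a w)) = {}"
    by (simp add: descents_empty_iff)
  have bound: "0 < s \<and> s < sum_list a" if "s \<in> descents a (?M (cut a w))" for s
    using that descents_subset comp_set_bounds[OF a(2)] by blast
  show ?case
  proof (cases "A = []")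
    case True
    then show ?thesis using sorted by (auto simp: block_consistent_def comp_set_Cons)
  next
    case False
    then have ne: "concat A \<noteq> []" using Cons.prems by (cases A) auto
    then have cut_ne: "cut (concat A) ?v \<noteq> []" "cut a w \<noteq> []"
      using a by (metis length_0_conv length_cut)+
    \<comment> \<open>A descent at 0 would be shifted onto the boundary \<open>sum_list a\<close>,
      where descents are permitted, and would go undetected.\<close>
    have zero: "0 \<notin> descents (concat A) ms" for ms :: "'a list"
    proof -
      have "0 \<notin> set (concat A)" using Cons.prems(1) by simp
      then show ?thesis
        using descents_subset[of "concat A" ms] comp_set_bounds(1)[of "concat A" 0] by blast
    qed
    have D: "descents (a @ concat A) (?M (cut a w) @ ?M (cut (concat A) ?v)) =
       descents a (?M (cut a w)) \<union>
       (if last (?M (cut a w)) < hd (?M (cut (concat A) ?v)) then {} else {sum_list a}) \<union>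
       (+) (sum_list a) ` descents (concat A) (?M (cut (concat A) ?v))"
      using cut_ne by (intro descents_append) auto
    have "descents (a @ concat A) (?M (cut a w) @ ?M (cut (concat A) ?v)) \<subseteq>
        comp_set (sum_list a # map sum_list A) \<longleftrightarrow>
        descents a (?M (cut a w)) = {} \<and>
        descents (concat A) (?M (cut (concat A) ?v)) \<subseteq> comp_set (map sum_list A)"
      unfolding D comp_set_Cons using False bound zero
      by (simp only: map_is_Nil_conv if_False) (rule shifted_union_subset_iff, auto)
    then show ?thesis
      by (auto simp: cut_append block_consistent_def IH sorted)
  qed
qed simp

section \<open>Counting consistent permutations\<close>

text \<open>A word amounts to the set \<open>S\<close> of its first \<open>a\<close> letters and an
  arrangement of each of \<open>S\<close> and \<open>X - S\<close>. The number of admissible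
  arrangements depends only on the cardinality, so the count is the binomial coefficient times
  \<open>fact a / p\<close> times \<open>fact (card X - a) / q\<close>. Multiplying out the
  denominators keeps everything in the natural numbers.\<close>

lemma card_permutations_split:
  assumes "finite X" "a \<le> card X"
    and P: "\<And>S. S \<subseteq> X \<Longrightarrow> card S = a \<Longrightarrow>
      card {u \<in> permutations_of_set S. P u} * p = fact a"
    and Q: "\<And>S. S \<subseteq> X \<Longrightarrow> card S = card X - a \<Longrightarrow>
      card {v \<in> permutations_of_set S. Q v} * q = fact (card X - a)"
  shows "card {w \<in> permutations_of_set X. P (take a w) \<and> Q (drop a w)} * (p * q) = fact (card X)"
proof -
  let ?S = "{S. S \<subseteq> X \<and> card S = a}"
  let ?P = "\<lambda>S. {u \<in> permutations_of_set S. P u}"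
  let ?Q = "\<lambda>S. {v \<in> permutations_of_set (X - S). Q v}"
  have len: "length w = card X" if "w \<in> permutations_of_set X" for w
    using that by (rule length_finite_permutations_of_set)
  have split: "set (drop a w) = X - set (take a w)" "set (take a w) \<subseteq> X"
    "card (set (take a w)) = a" if w: "w \<in> permutations_of_set X" for w
  proof -
    have "set (take a w) \<union> set (drop a w) = X" "set (take a w) \<inter> set (drop a w) = {}"
      using permutations_of_setD[OF w] by (metis append_take_drop_id set_append distinct_append)+
    then show "set (drop a w) = X - set (take a w)" "set (take a w) \<subseteq> X" by auto
    show "card (set (take a w)) = a"
      using w len[OF w] assms(2) by (simp add: permutations_of_set_def distinct_card)
  qed
  have "bij_betw (\<lambda>w. (set (take a w), take a w, drop a w))
      {w \<in> permutations_of_set X. P (take a w) \<and> Q (drop a w)} (SIGMA S:?S. ?P S \<times> ?Q S)"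
  proof (rule bij_betw_byWitness[where f' = "\<lambda>(S, u, v). u @ v"])
    show "\<forall>x \<in> SIGMA S:?S. ?P S \<times> ?Q S.
        (\<lambda>w. (set (take a w), take a w, drop a w)) ((\<lambda>(S, u, v). u @ v) x) = x"
    proof
      fix x assume "x \<in> (SIGMA S:?S. ?P S \<times> ?Q S)"
      then obtain S u v where x: "x = (S, u, v)" and "u \<in> permutations_of_set S" "card S = a"
        by auto
      then have "length u = a" "set u = S"
        using length_finite_permutations_of_set permutations_of_setD(1) by blast+
      then show "(\<lambda>w. (set (take a w), take a w, drop a w)) ((\<lambda>(S, u, v). u @ v) x) = x"
        using x by simp
    qed
    show "(\<lambda>w. (set (take a w), take a w, drop a w)) `
        {w \<in> permutations_of_set X. P (take a w) \<and> Q (drop a w)} \<subseteq> (SIGMA S:?S. ?P S \<times> ?Q S)"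
      using split by (auto dest: permutations_of_setD intro!: permutations_of_setI)
    show "(\<lambda>(S, u, v). u @ v) ` (SIGMA S:?S. ?P S \<times> ?Q S) \<subseteq>
        {w \<in> permutations_of_set X. P (take a w) \<and> Q (drop a w)}"
    proof
      fix w assume "w \<in> (\<lambda>(S, u, v). u @ v) ` (SIGMA S:?S. ?P S \<times> ?Q S)"
      then obtain S u v where w: "w = u @ v"
        and "u \<in> permutations_of_set S" "v \<in> permutations_of_set (X - S)"
        and S: "S \<subseteq> X" "card S = a" and PQ: "P u" "Q v"
        by auto
      then have u: "length u = a" "set u = S" "distinct u" and v: "set v = X - S" "distinct v"
        using length_finite_permutations_of_set permutations_of_setD by blast+
      then have "u @ v \<in> permutations_of_set X"
        using S(1) by (intro permutations_of_setI) auto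
      with u PQ w show "w \<in> {w \<in> permutations_of_set X. P (take a w) \<and> Q (drop a w)}"
        by simp
    qed
  qed auto
  then have "card {w \<in> permutations_of_set X. P (take a w) \<and> Q (drop a w)} =
      card (SIGMA S:?S. ?P S \<times> ?Q S)"
    by (rule bij_betw_same_card)
  also have "\<dots> = (\<Sum>S\<in>?S. card (?P S) * card (?Q S))"
    using assms(1) by (simp add: card_cartesian_product)
  finally have "card {w \<in> permutations_of_set X. P (take a w) \<and> Q (drop a w)} * (p * q) =
      (\<Sum>S\<in>?S. (card (?P S) * p) * (card (?Q S) * q))"
    by (simp only: sum_distrib_right) (simp only: mult_ac)
  also have "\<dots> = (\<Sum>S\<in>?S. fact a * fact (card X - a))"
  proof (rule sum.cong)
    fix S assume S: "S \<in> ?S"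
    then have "card (X - S) = card X - a"
      using assms(1) by (auto simp: card_Diff_subset finite_subset)
    then have "card (?Q S) * q = fact (card X - a)" using Q by blast
    moreover have "card (?P S) * p = fact a" using P S by blast
    ultimately show "card (?P S) * p * (card (?Q S) * q) = fact a * fact (card X - a)" by simp
  qed simp
  also have "\<dots> = fact a * fact (card X - a) * (card X choose a)"
    using assms(1) by (simp add: n_subsets)
  finally show ?thesis by (simp only: binomial_fact_lemma[OF assms(2)])
qed

lemma pi_comp_snoc: "pi_comp (ks @ [k]) = pi_comp ks * (sum_list ks + k)"
  by (simp add: pi_comp_def)

lemma set_cut:
  assumes "length w = sum_list ks"
  shows "(\<Union>c \<in> set (cut ks w). set c) = set w"
  using assms
proof (induction ks arbitrary: w)
  case (Cons k ks)
  then have "(\<Union>c \<in> set (cut ks (drop k w)). set c) = set (drop k w)" by simp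
  then show ?case by (simp flip: set_append)
qed simp

lemma cut_not_Nil:
  assumes "length w = sum_list ks" "0 \<notin> set ks"
  shows "[] \<notin> set (cut ks w)"
  using assms by (induction ks arbitrary: w) auto

text \<open>Increasing cycle maxima put the overall maximum into the last cycle, where it has to
  come last. Conversely, if the word ends in \<open>Max X\<close>, distinctness makes every earlier
  letter, hence every earlier cycle maximum, strictly smaller.\<close>

lemma block_consistent_snoc:
  assumes w: "w \<in> permutations_of_set X" and pos: "0 \<notin> set (ks @ [k])"
    and len: "card X = sum_list (ks @ [k])"
  shows "block_consistent (ks @ [k]) w \<longleftrightarrow> block_consistent ks w \<and> last w = Max X"
proof -
  define u where "u = take (sum_list ks) w"
  define v where "v = drop (sum_list ks) w"
  have lw: "length w = sum_list ks + k"
    using length_finite_permutations_of_set[OF w] len by simp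
  have "set (u @ v) = X" "distinct (u @ v)"
    using w unfolding u_def v_def by (simp_all only: append_take_drop_id permutations_of_setD)
  then have X: "X = set u \<union> set v" and dist: "set u \<inter> set v = {}" by auto
  have lu: "length u = sum_list ks" and v: "v \<noteq> []" "take k v = v" and lv: "last w = last v"
    using lw pos by (auto simp: u_def v_def)
  have cut: "cut ks w = cut ks u" by (simp add: u_def cut_take)
  have U: "(\<Union>c \<in> set (cut ks u). set c) = set u" by (rule set_cut[OF lu])
  have ne: "[] \<notin> set (cut ks u)" using cut_not_Nil[OF lu] pos by simp
  have "(\<forall>c \<in> set (cut ks u). Max (set c) < Max (set v)) \<longleftrightarrow> (\<forall>x \<in> set u. x < Max (set v))"
  proof -
    have "Max (set c) < Max (set v) \<longleftrightarrow> (\<forall>x \<in> set c. x < Max (set v))" if "c \<in> set (cut ks u)" for c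
      using that ne by (subst Max_less_iff) auto
    then show ?thesis unfolding U[symmetric] by blast
  qed
  moreover have "last v = Max (set v) \<and> (\<forall>x \<in> set u. x < Max (set v)) \<longleftrightarrow> last v = Max X"
  proof
    assume "last v = Max (set v) \<and> (\<forall>x \<in> set u. x < Max (set v))"
    then show "last v = Max X"
      using v X by (intro Max_eqI[symmetric]) (auto simp: less_imp_le)
  next
    assume *: "last v = Max X"
    have le: "x \<le> last v" if "x \<in> X" for x using that X * by simp
    then have "Max (set v) = last v" using v X by (intro Max_eqI) auto
    moreover have "x < last v" if "x \<in> set u" for x
      using le[of x] that X dist v last_in_set[of v] by (metis UnI1 disjoint_iff order_le_less)
    ultimately show "last v = Max (set v) \<and> (\<forall>x \<in> set u. x < Max (set v))" by simp
  qed
  ultimately show ?thesis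
    using v lv by (auto simp: block_consistent_def cut_append cut last_Max_def sorted_wrt_append
        simp flip: v_def)
qed

text \<open>Deleting the forced last letter \<open>Max X\<close> leaves an arbitrary word in the
  other letters, subject only to the condition of \<open>ks\<close> on its prefix. So the count is
  \<open>fact (card X - 1)\<close> divided by \<open>pi_comp ks\<close>, and the extra factor of
  \<open>pi_comp (ks @ [k])\<close> is \<open>card X\<close> itself.\<close>

lemma card_block_consistent:
  assumes "finite X" "0 \<notin> set ks" "card X = sum_list ks"
  shows "card {w \<in> permutations_of_set X. block_consistent ks w} * pi_comp ks = fact (card X)"
  using assms
proof (induction ks arbitrary: X rule: rev_induct)
  case Nil
  then have "{w \<in> permutations_of_set X. block_consistent [] w} = {[]}"
    by (auto simp: block_consistent_def)
  then show ?case using Nil by (simp add: pi_comp_def)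
next
  case (snoc k ks)
  let ?m = "Max X" and ?X = "X - {Max X}"
  have k: "0 < k" using snoc.prems by auto
  have ne: "X \<noteq> {}" using snoc.prems k by auto
  then have m: "?m \<in> X" using snoc.prems by simp
  have card: "card ?X = card X - 1" using m by (rule card_Diff_singleton)
  have "{w \<in> permutations_of_set X. block_consistent (ks @ [k]) w} =
      (\<lambda>w. w @ [?m]) ` {w \<in> permutations_of_set ?X. block_consistent ks (take (sum_list ks) w)}"
    (is "?L = _ ` ?R")
  proof (intro equalityI subsetI)
    fix w assume "w \<in> ?L"
    then have w: "w \<in> permutations_of_set X" "block_consistent ks w" "last w = ?m"
      using block_consistent_snoc snoc.prems by blast+
    have "w \<noteq> []" using w(1) ne by (auto simp: permutations_of_set_def)
    then have bw: "w = butlast w @ [?m]" using w(3) by (metis append_butlast_last_id)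
    have "length w = sum_list ks + k"
      using length_finite_permutations_of_set[OF w(1)] snoc.prems by simp
    \<comment> \<open>Since \<open>k\<close> is positive, the prefix does not reach the deleted
      letter.\<close>
    then have "take (sum_list ks) (butlast w) = take (sum_list ks) w"
      using k by (simp add: take_butlast)
    then have "block_consistent ks (take (sum_list ks) (butlast w))"
      using w(2) by (simp add: block_consistent_take)
    moreover have "distinct (butlast w @ [?m])" "set (butlast w @ [?m]) = X"
      using w(1) bw by (simp_all add: permutations_of_set_def)
    then have "butlast w \<in> permutations_of_set ?X"
      by (auto simp: permutations_of_set_def)
    ultimately show "w \<in> (\<lambda>w. w @ [?m]) ` ?R" using bw by blast
  next
    fix w assume "w \<in> (\<lambda>w. w @ [?m]) ` ?R"
    then obtain u where u: "w = u @ [?m]" "u \<in> permutations_of_set ?X"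
      "block_consistent ks (take (sum_list ks) u)" by blast
    have w: "w \<in> permutations_of_set X"
      using permutations_of_setD[OF u(2)] u(1) insert_Diff[OF m]
      by (intro permutations_of_setI) simp_all
    have "length u = card X - 1"
      using length_finite_permutations_of_set[OF u(2)] card by (rule trans)
    then have "length u = sum_list ks + k - 1" using snoc.prems(3) by simp
    then have "take (sum_list ks) u = take (sum_list ks) w" using k u(1) by simp
    then have "block_consistent ks w" using u(3) by (simp add: block_consistent_take)
    then show "w \<in> ?L"
      using block_consistent_snoc[OF w snoc.prems(2,3)] w u(1) by simp
  qed
  then have "card ?L = card ?R" by (simp add: card_image inj_on_def)
  \<comment> \<open>The \<open>k - 1\<close> letters after the prefix are unconstrained, which is
    the splitting lemma with the predicate \<open>True\<close> and the factor 1.\<close>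
  moreover have "card {w \<in> permutations_of_set ?X.
      block_consistent ks (take (sum_list ks) w) \<and> True} * (pi_comp ks * 1) = fact (card ?X)"
  proof (rule card_permutations_split)
    show "sum_list ks \<le> card ?X" using snoc.prems(3) k unfolding card by simp
    fix S assume S: "S \<subseteq> ?X" "card S = sum_list ks"
    then have "finite S" using snoc.prems(1) by (meson finite_Diff finite_subset)
    with S show "card {u \<in> permutations_of_set S. block_consistent ks u} * pi_comp ks =
        fact (sum_list ks)"
      using snoc.IH[of S] snoc.prems(2) by simp
  next
    fix S assume S: "S \<subseteq> ?X" "card S = card ?X - sum_list ks"
    then have "finite S" using snoc.prems(1) by (meson finite_Diff finite_subset)
    then show "card {v \<in> permutations_of_set S. True} * 1 = fact (card ?X - sum_list ks)"
      using S(2) by simp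
  qed (use snoc.prems in simp)
  ultimately have L: "card ?L * pi_comp ks = fact (card X - 1)"
    using card by (simp only: mult_1_right simp_thms)
  have "card ?L * pi_comp (ks @ [k]) = card X * (card ?L * pi_comp ks)"
    using snoc.prems(3) by (simp add: pi_comp_snoc)
  also have "\<dots> = fact (card X)"
    unfolding L using snoc.prems(3) k by (subst fact_reduce) simp_all
  finally show ?case .
qed

text \<open>The conditions on different blocks concern disjoint segments of the word, so splitting
  off the first block multiplies the denominators.\<close>

lemma card_blocks_consistent:
  assumes "finite X" "0 \<notin> set (concat A)" "card X = sum_list (concat A)"
  shows "card {w \<in> permutations_of_set X. blocks_consistent A w} * prod_list (map pi_comp A) =
    fact (card X)"
  using assms
proof (induction A arbitrary: X)
  case Nil
  then show ?case by simp
next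
  case (Cons a A)
  have "card {w \<in> permutations_of_set X. block_consistent a (take (sum_list a) w) \<and>
      blocks_consistent A (drop (sum_list a) w)} * (pi_comp a * prod_list (map pi_comp A)) =
      fact (card X)"
  proof (rule card_permutations_split)
    fix S assume S: "S \<subseteq> X" "card S = sum_list a"
    then have "finite S" using Cons.prems(1) finite_subset by blast
    then show "card {w \<in> permutations_of_set S. block_consistent a w} * pi_comp a =
        fact (sum_list a)"
      using card_block_consistent[of S a] S Cons.prems by simp
  next
    fix S assume S: "S \<subseteq> X" "card S = card X - sum_list a"
    then have "finite S" using Cons.prems(1) finite_subset by blast
    then show "card {w \<in> permutations_of_set S. blocks_consistent A w} *
        prod_list (map pi_comp A) = fact (card X - sum_list a)"
      using Cons.IH[of S] S Cons.prems by simp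
  qed (use Cons.prems in auto)
  then show ?case by (simp add: block_consistent_take)
qed

lemma card_Cons_perms:
  assumes "\<alpha> \<in> compositions n" "\<alpha> \<preceq> \<beta>"
  shows "card (Cons_perms \<alpha> \<beta>) * pi_refine \<alpha> \<beta> = fact n"
proof -
  have "Cons_perms \<alpha> \<beta> =
      {w \<in> permutations_of_set {1..sum_list \<alpha>}. blocks_consistent (comp_blocks \<alpha> \<beta>) w}"
    by (simp add: Cons_perms_def consistent_iff_blocks[OF assms(2)])
  then show ?thesis
    using card_blocks_consistent[of "{1..n}" "comp_blocks \<alpha> \<beta>"] assms comp_blocks(1)[OF assms(2)]
    by (simp add: pi_refine_def compositions_def)
qed

section \<open>The coarsest composition of a permutation\<close>

text \<open>This confines the dependence on \<beta> to one inclusion, which is monotone in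
  \<open>comp_set \<beta>\<close>; hence a coarsest \<beta> exists.\<close>

lemma consistent_iff_descents:
  assumes "\<alpha> \<preceq> \<beta>"
  shows "consistent \<alpha> \<beta> \<sigma> \<longleftrightarrow> (\<forall>c \<in> set (cut \<alpha> \<sigma>). last_Max c) \<and>
    descents \<alpha> (map (\<lambda>c. Max (set c)) (cut \<alpha> \<sigma>)) \<subseteq> comp_set \<beta>"
proof -
  have "0 \<notin> set \<alpha>" "0 \<notin> set \<beta>" using assms by (auto simp: refines_def compositions_def)
  \<comment> \<open>An empty block would give \<beta> a part equal to 0.\<close>
  moreover from this have "[] \<notin> set (comp_blocks \<alpha> \<beta>)"
    by (metis comp_blocks(2)[OF assms] image_eqI list.set_map sum_list.Nil)
  ultimately show ?thesis
    using blocks_consistent_iff_descents[of "comp_blocks \<alpha> \<beta>" \<sigma>]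
    by (simp add: consistent_iff_blocks assms comp_blocks)
qed

lemma refines_refl: "\<alpha> \<in> compositions n \<Longrightarrow> \<alpha> \<preceq> \<alpha>"
  by (auto simp: refines_def)

text \<open>The descent set is the least set that the inclusion in
  \<open>consistent_iff_descents\<close> allows. It lies in \<open>comp_set \<alpha>\<close>, so it
  is the set of a coarsening of \<alpha>, and a least set means a coarsest composition.\<close>

lemma coarsest_eq:
  assumes \<alpha>: "\<alpha> \<in> compositions n" and \<sigma>: "\<sigma> \<in> Cons_perms \<alpha> \<alpha>"
  shows "coarsest \<alpha> \<sigma> = comp_of_set n (descents \<alpha> (map (\<lambda>c. Max (set c)) (cut \<alpha> \<sigma>)))"
    (is "_ = comp_of_set n ?D")
proof -
  let ?\<gamma> = "comp_of_set n ?D"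
  have sub: "?D \<subseteq> comp_set \<alpha>" by (rule descents_subset)
  then have \<gamma>: "?\<gamma> \<in> compositions n" "comp_set ?\<gamma> = ?D"
    using comp_of_set[of ?D n] comp_set_subset[OF \<alpha>] by auto
  then have \<alpha>\<gamma>: "\<alpha> \<preceq> ?\<gamma>" using sub by (simp add: refines_iff_right[OF \<alpha>])
  have Cons: "\<sigma> \<in> Cons_perms \<alpha> \<beta> \<longleftrightarrow> \<beta> \<preceq> ?\<gamma>" if "\<alpha> \<preceq> \<beta>" for \<beta>
    using \<sigma> that \<gamma> refines_refl[OF \<alpha>]
    by (auto simp: Cons_perms_def consistent_iff_descents refines_iff_left refines_iff_right[OF \<alpha>])
  show ?thesis
    unfolding coarsest_def
  proof (rule the_equality)
    show "\<alpha> \<preceq> ?\<gamma> \<and> \<sigma> \<in> Cons_perms \<alpha> ?\<gamma> \<and>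
        (\<forall>\<beta>'. \<alpha> \<preceq> \<beta>' \<and> \<sigma> \<in> Cons_perms \<alpha> \<beta>' \<longrightarrow> \<beta>' \<preceq> ?\<gamma>)"
      using \<alpha>\<gamma> Cons refines_refl[OF \<gamma>(1)] by blast
  next
    fix \<beta>
    assume "\<alpha> \<preceq> \<beta> \<and> \<sigma> \<in> Cons_perms \<alpha> \<beta> \<and>
        (\<forall>\<beta>'. \<alpha> \<preceq> \<beta>' \<and> \<sigma> \<in> Cons_perms \<alpha> \<beta>' \<longrightarrow> \<beta>' \<preceq> \<beta>)"
    then show "\<beta> = ?\<gamma>"
      using \<alpha>\<gamma> Cons refines_refl[OF \<gamma>(1)] refines_antisym by blast
  qed
qed

text \<open>Both sides say that the descent set of \<sigma> is contained in
  \<open>comp_set \<beta>\<close>.\<close>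

lemma refines_coarsest_iff:
  assumes "\<alpha> \<in> compositions n" "\<sigma> \<in> Cons_perms \<alpha> \<alpha>" "\<alpha> \<preceq> \<beta>"
  shows "\<beta> \<preceq> coarsest \<alpha> \<sigma> \<longleftrightarrow> \<sigma> \<in> Cons_perms \<alpha> \<beta>"
proof -
  let ?D = "descents \<alpha> (map (\<lambda>c. Max (set c)) (cut \<alpha> \<sigma>))"
  have "comp_of_set n ?D \<in> compositions n" "comp_set (comp_of_set n ?D) = ?D"
    using comp_of_set[of ?D n] descents_subset[of \<alpha>] comp_set_subset[OF assms(1)] by blast+
  then show ?thesis
    using assms(2,3) refines_refl[OF assms(1)]
    by (auto simp: coarsest_eq[OF assms(1,2)] Cons_perms_def consistent_iff_descents
        refines_iff_left refines_iff_right[OF assms(1)])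
qed

lemma refines_coarsest:
  assumes "\<alpha> \<in> compositions n" "\<sigma> \<in> Cons_perms \<alpha> \<alpha>"
  shows "\<alpha> \<preceq> coarsest \<alpha> \<sigma>"
  using assms refines_coarsest_iff refines_refl by blast

lemma Cons_perms_eq:
  assumes "\<alpha> \<in> compositions n" "\<alpha> \<preceq> \<beta>"
  shows "Cons_perms \<alpha> \<beta> = {\<sigma> \<in> Cons_perms \<alpha> \<alpha>. \<beta> \<preceq> coarsest \<alpha> \<sigma>}"
proof -
  have "Cons_perms \<alpha> \<beta> \<subseteq> Cons_perms \<alpha> \<alpha>"
    using assms(2) refines_refl[OF assms(1)] descents_subset
    by (auto simp: Cons_perms_def consistent_iff_descents)
  then show ?thesis using refines_coarsest_iff[OF assms(1) _ assms(2)] by blast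
qed

text \<open>The permutations consistent with \<open>\<alpha> \<preceq> \<beta>\<close> are grouped
  by their coarsest composition; a group with \<open>\<beta> \<preceq> \<gamma>\<close> is a full
  fibre of \<open>coarsest \<alpha>\<close> on \<open>Cons_perms \<alpha> \<alpha>\<close>.\<close>

lemma sum_card_coarsest:
  assumes "\<alpha> \<in> compositions n" "\<alpha> \<preceq> \<beta>"
  shows "(\<Sum>\<gamma> | \<alpha> \<preceq> \<gamma> \<and> \<beta> \<preceq> \<gamma>. card {\<sigma> \<in> Cons_perms \<alpha> \<alpha>. coarsest \<alpha> \<sigma> = \<gamma>}) =
    card (Cons_perms \<alpha> \<beta>)"
proof -
  let ?T = "{\<gamma>. \<alpha> \<preceq> \<gamma> \<and> \<beta> \<preceq> \<gamma>}"
  have "(\<Sum>\<gamma>\<in>?T. \<Sum>\<sigma> | \<sigma> \<in> Cons_perms \<alpha> \<beta> \<and> coarsest \<alpha> \<sigma> = \<gamma>. 1) = (\<Sum>\<sigma>\<in>Cons_perms \<alpha> \<beta>. 1::nat)"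
  proof (rule sum.group)
    show "finite (Cons_perms \<alpha> \<beta>)" by (simp add: Cons_perms_def)
    show "finite ?T"
      by (rule finite_subset[of _ "compositions n"]) (auto simp: refines_iff_right[OF assms(1)])
    show "coarsest \<alpha> ` Cons_perms \<alpha> \<beta> \<subseteq> ?T"
      using refines_coarsest[OF assms(1)] Cons_perms_eq[OF assms] by auto
  qed
  moreover have "{\<sigma> \<in> Cons_perms \<alpha> \<beta>. coarsest \<alpha> \<sigma> = \<gamma>} =
      {\<sigma> \<in> Cons_perms \<alpha> \<alpha>. coarsest \<alpha> \<sigma> = \<gamma>}" if "\<gamma> \<in> ?T" for \<gamma>
    using that Cons_perms_eq[OF assms] by auto
  ultimately show ?thesis by simp
qed

section \<open>The alternating sum of fundamental functions\<close>

lemma sum_apply: "(\<Sum>x\<in>A. f x) m = (\<Sum>x\<in>A. f x m)"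
  by (induction A rule: infinite_finite_induct) auto

text \<open>This is the expansion of the product over \<open>V\<close> of the factors
  \<open>1 - 1\<close>.\<close>

lemma sum_Pow_neg_one_card:
  assumes "finite V"
  shows "(\<Sum>E\<in>Pow V. (- 1) ^ card E) = (if V = {} then 1 else 0 :: 'a::comm_ring_1)"
  using prod_diff_conv_sum[OF assms, of "\<lambda>_. 1" "\<lambda>_. 1 :: 'a"] assms
  by (cases "V = {}") (simp_all add: card_gt_0_iff zero_power)

text \<open>Via \<open>comp_set\<close> the sum runs over the subsets of \<open>V\<close>, with
  \<open>length \<eta> - 1\<close> as their cardinality. For the empty composition the truncated
  subtraction gives 0, as it should for the empty set.\<close>

lemma sum_neg_one_length:
  assumes "V \<subseteq> {1..n - 1}"
  shows "(\<Sum>\<eta> | \<eta> \<in> compositions n \<and> comp_set \<eta> \<subseteq> V. (- 1) ^ (length \<eta> - 1)) =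
    (if V = {} then 1 else 0 :: 'a::comm_ring_1)"
proof -
  let ?S = "{\<eta>. \<eta> \<in> compositions n \<and> comp_set \<eta> \<subseteq> V}"
  have "Pow V \<subseteq> comp_set ` ?S"
  proof
    fix E assume "E \<in> Pow V"
    then have "E \<subseteq> V" "E \<subseteq> {1..n - 1}" using assms by auto
    then show "E \<in> comp_set ` ?S" using comp_set_surj[of E n] by blast
  qed
  then have "comp_set ` ?S = Pow V" by blast
  then have "bij_betw comp_set ?S (Pow V)"
    by (intro bij_betw_subset[OF bij_betw_comp_set[of n]]) auto
  then have "(\<Sum>\<eta>\<in>?S. (- 1 :: 'a) ^ card (comp_set \<eta>)) = (\<Sum>E\<in>Pow V. (- 1) ^ card E)"
    by (rule sum.reindex_bij_betw)
  also have "\<dots> = (if V = {} then 1 else 0)"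
    using assms finite_subset by (intro sum_Pow_neg_one_card) blast
  finally show ?thesis by (simp add: card_comp_set compositions_def)
qed

lemma alternating_sum_F_qsym:
  assumes \<alpha>: "\<alpha> \<in> compositions n" and "\<alpha> \<preceq> \<gamma>"
  shows "(\<Sum>\<eta> | comp_compl \<alpha> \<preceq> \<eta>. (- 1) ^ (length \<eta> - 1) *\<^sub>s F_qsym (comp_join \<gamma> \<eta>)) =
    (\<Sum>\<beta> | \<alpha> \<preceq> \<beta> \<and> \<beta> \<preceq> \<gamma>. M_qsym \<beta> :: 'a::field_char_0 series)"
proof
  fix m
  let ?U = "{1..n - 1} - comp_set \<alpha>"
  let ?N = "{\<eta>. \<eta> \<in> compositions n \<and> comp_set \<eta> \<subseteq> ?U}"
  let ?M = "\<lambda>\<beta>. M_qsym \<beta> m :: 'a"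
  let ?G = "{\<beta> \<in> compositions n. comp_set \<gamma> \<subseteq> comp_set \<beta>}"
  have \<gamma>: "\<gamma> \<in> compositions n" using assms by (simp add: refines_iff_right)
  have sums: "sum_list \<alpha> = n" "sum_list \<gamma> = n" using \<alpha> \<gamma> by (auto simp: compositions_def)
  have compl: "{\<eta>. comp_compl \<alpha> \<preceq> \<eta>} = ?N"
    using comp_of_set[of ?U n] by (auto simp: comp_compl_def sums refines_iff_right)
  \<comment> \<open>Writing the condition on \<eta> as an indicator makes the range
    \<open>?G\<close> independent of \<eta>, so that the two sums can be exchanged.\<close>
  have F: "F_qsym (comp_join \<gamma> \<eta>) m = (\<Sum>\<beta>\<in>?G. if comp_set \<eta> \<subseteq> comp_set \<beta> then ?M \<beta> else 0)"
    if "\<eta> \<in> ?N" for \<eta>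
  proof -
    have "comp_set \<gamma> \<union> comp_set \<eta> \<subseteq> {1..n - 1}"
      using comp_set_subset[OF \<gamma>] comp_set_subset[of \<eta>] that by simp
    note join = comp_of_set[OF this]
    have "{\<beta>. \<beta> \<preceq> comp_join \<gamma> \<eta>} = {\<beta> \<in> ?G. comp_set \<eta> \<subseteq> comp_set \<beta>}"
      by (auto simp: comp_join_def sums refines_iff_left[OF join(1)] join(2))
    then show ?thesis
      unfolding F_qsym_def sum_apply by (simp only:) (rule sum.inter_filter, simp)
  qed
  \<comment> \<open>The surviving \<eta> are those whose set lies in
    \<open>?U \<inter> comp_set \<beta>\<close>; their signs cancel unless this intersection is
    empty.\<close>
  have inner: "(\<Sum>\<eta>\<in>?N. if comp_set \<eta> \<subseteq> comp_set \<beta> then (- 1 :: 'a) ^ (length \<eta> - 1) else 0) =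
      (if comp_set \<beta> \<subseteq> comp_set \<alpha> then 1 else 0)" if "\<beta> \<in> ?G" for \<beta>
  proof -
    have "finite ?N" by simp
    then have "(\<Sum>\<eta>\<in>?N. if comp_set \<eta> \<subseteq> comp_set \<beta> then (- 1 :: 'a) ^ (length \<eta> - 1) else 0) =
        (\<Sum>\<eta> | \<eta> \<in> compositions n \<and> comp_set \<eta> \<subseteq> ?U \<inter> comp_set \<beta>. (- 1) ^ (length \<eta> - 1))"
      by (subst sum.inter_filter[symmetric]) (auto intro: sum.cong)
    also have "\<dots> = (if ?U \<inter> comp_set \<beta> = {} then 1 else 0)"
      by (rule sum_neg_one_length) auto
    also have "?U \<inter> comp_set \<beta> = {} \<longleftrightarrow> comp_set \<beta> \<subseteq> comp_set \<alpha>"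
      using comp_set_subset[of \<beta> n] that by blast
    finally show ?thesis .
  qed
  have "(\<Sum>\<eta> | comp_compl \<alpha> \<preceq> \<eta>. (- 1) ^ (length \<eta> - 1) *\<^sub>s F_qsym (comp_join \<gamma> \<eta>)) m =
      (\<Sum>\<eta>\<in>?N. \<Sum>\<beta>\<in>?G. ?M \<beta> *
        (if comp_set \<eta> \<subseteq> comp_set \<beta> then (- 1) ^ (length \<eta> - 1) else 0))"
    unfolding compl sum_apply series_scale_def
    by (intro sum.cong refl) (simp add: F sum_distrib_left if_distrib mult.commute cong: if_cong)
  also have "\<dots> = (\<Sum>\<beta>\<in>?G. ?M \<beta> *
      (\<Sum>\<eta>\<in>?N. if comp_set \<eta> \<subseteq> comp_set \<beta> then (- 1) ^ (length \<eta> - 1) else 0))"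
    by (subst sum.swap) (simp add: sum_distrib_left)
  also have "\<dots> = (\<Sum>\<beta>\<in>?G. if comp_set \<beta> \<subseteq> comp_set \<alpha> then ?M \<beta> else 0)"
    by (intro sum.cong refl) (simp only: inner, simp)
  also have "\<dots> = (\<Sum>\<beta> | \<beta> \<in> ?G \<and> comp_set \<beta> \<subseteq> comp_set \<alpha>. ?M \<beta>)"
    by (rule sum.inter_filter[symmetric]) simp
  also have "{\<beta>. \<beta> \<in> ?G \<and> comp_set \<beta> \<subseteq> comp_set \<alpha>} = {\<beta>. \<alpha> \<preceq> \<beta> \<and> \<beta> \<preceq> \<gamma>}"
    by (auto simp: refines_iff_right[OF \<alpha>] refines_iff_left[OF \<gamma>])
  finally show "(\<Sum>\<eta> | comp_compl \<alpha> \<preceq> \<eta>. (- 1) ^ (length \<eta> - 1) *\<^sub>s F_qsym (comp_join \<gamma> \<eta>)) m =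
      (\<Sum>\<beta> | \<alpha> \<preceq> \<beta> \<and> \<beta> \<preceq> \<gamma>. M_qsym \<beta> :: 'a series) m"
    by (simp add: sum_apply)
qed

section \<open>Comparison of the coefficients of the monomial functions\<close>

theorem theorem4p4:
  fixes \<alpha> :: "nat list" and n :: nat
  assumes "\<alpha> \<in> compositions n"
  shows "(Psi_qsym \<alpha> :: 'a::field_char_0 series) =
    (of_nat (z_comp \<alpha>) / fact n) *\<^sub>s
      (\<Sum>\<gamma> | \<alpha> \<preceq> \<gamma>.
         of_nat (card {\<sigma> \<in> Cons_perms \<alpha> \<alpha>. coarsest \<alpha> \<sigma> = \<gamma>}) *\<^sub>s
           (\<Sum>\<eta> | comp_compl \<alpha> \<preceq> \<eta>.
              (- 1) ^ (length \<eta> - 1) *\<^sub>s F_qsym (comp_join \<gamma> \<eta>)))"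
proof
  fix m
  let ?R = "{\<gamma>. \<alpha> \<preceq> \<gamma>}"
  let ?M = "\<lambda>\<beta>. M_qsym \<beta> m :: 'a"
  let ?c = "\<lambda>\<gamma>. card {\<sigma> \<in> Cons_perms \<alpha> \<alpha>. coarsest \<alpha> \<sigma> = \<gamma>}"
  have fin: "finite ?R" by (simp add: refines_iff_right[OF assms])
  define S :: "'a series" where "S = (\<Sum>\<gamma>\<in>?R. of_nat (?c \<gamma>) *\<^sub>s
      (\<Sum>\<eta> | comp_compl \<alpha> \<preceq> \<eta>. (- 1) ^ (length \<eta> - 1) *\<^sub>s F_qsym (comp_join \<gamma> \<eta>)))"
  have "S m = (\<Sum>\<gamma>\<in>?R. of_nat (?c \<gamma>) * (\<Sum>\<beta> | \<beta> \<in> ?R \<and> \<beta> \<preceq> \<gamma>. ?M \<beta>))"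
  proof (subst S_def, subst sum_apply, intro sum.cong refl)
    fix \<gamma> assume "\<gamma> \<in> ?R"
    then have "\<alpha> \<preceq> \<gamma>" by simp
    note alternating_sum_F_qsym[OF assms this, where 'a = 'a]
    then show "(of_nat (?c \<gamma>) *\<^sub>s (\<Sum>\<eta> | comp_compl \<alpha> \<preceq> \<eta>.
        (- 1) ^ (length \<eta> - 1) *\<^sub>s F_qsym (comp_join \<gamma> \<eta>))) m =
        of_nat (?c \<gamma>) * (\<Sum>\<beta> | \<beta> \<in> ?R \<and> \<beta> \<preceq> \<gamma>. ?M \<beta>)"
      by (simp only: series_scale_def[of "of_nat _"]) (simp add: sum_apply)
  qed
  \<comment> \<open>With \<open>\<beta> \<preceq> \<gamma>\<close> as an indicator both sums range
    over the coarsenings of \<alpha>. After the exchange the inner sum over \<gamma> counts the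
    permutations consistent with \<open>\<alpha> \<preceq> \<beta>\<close>.\<close>
  also have "\<dots> = (\<Sum>\<gamma>\<in>?R. \<Sum>\<beta>\<in>?R. if \<beta> \<preceq> \<gamma> then of_nat (?c \<gamma>) * ?M \<beta> else 0)"
    by (simp only: sum.inter_filter[OF fin] sum_distrib_left if_distrib[of "(*) _"] mult_zero_right)
  also have "\<dots> = (\<Sum>\<beta>\<in>?R. \<Sum>\<gamma> | \<gamma> \<in> ?R \<and> \<beta> \<preceq> \<gamma>. of_nat (?c \<gamma>) * ?M \<beta>)"
    by (subst sum.swap) (simp only: sum.inter_filter[OF fin])
  also have "\<dots> = (\<Sum>\<beta>\<in>?R. of_nat (card (Cons_perms \<alpha> \<beta>)) * ?M \<beta>)"
    by (intro sum.cong refl)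
      (simp add: sum_card_coarsest[OF assms, symmetric] flip: sum_distrib_right)
  also have "\<dots> = (\<Sum>\<beta>\<in>?R. fact n * (1 / of_nat (pi_refine \<alpha> \<beta>) * ?M \<beta>))"
  proof (intro sum.cong refl)
    fix \<beta> assume "\<beta> \<in> ?R"
    then have *: "card (Cons_perms \<alpha> \<beta>) * pi_refine \<alpha> \<beta> = fact n"
      using card_Cons_perms[OF assms] by simp
    \<comment> \<open>It divides a factorial, so division by it in the field is legitimate.\<close>
    then have "pi_refine \<alpha> \<beta> \<noteq> 0" by (metis fact_nonzero mult_0_right)
    moreover have "of_nat (card (Cons_perms \<alpha> \<beta>)) * of_nat (pi_refine \<alpha> \<beta>) = (fact n :: 'a)"
      using * by (metis of_nat_fact of_nat_mult)
    ultimately show "of_nat (card (Cons_perms \<alpha> \<beta>)) * ?M \<beta> =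
        fact n * (1 / of_nat (pi_refine \<alpha> \<beta>) * ?M \<beta>)"
      by (simp add: field_simps)
  qed
  also have "\<dots> = fact n * (\<Sum>\<beta>\<in>?R. 1 / of_nat (pi_refine \<alpha> \<beta>) * ?M \<beta>)"
    by (rule sum_distrib_left[symmetric])
  finally have "S m = fact n * (\<Sum>\<beta>\<in>?R. 1 / of_nat (pi_refine \<alpha> \<beta>) * ?M \<beta>)" .
  then have "Psi_qsym \<alpha> m = ((of_nat (z_comp \<alpha>) / fact n) *\<^sub>s S) m"
    by (simp add: Psi_qsym_def series_scale_def sum_apply)
  then show "(Psi_qsym \<alpha> :: 'a series) m = ((of_nat (z_comp \<alpha>) / fact n) *\<^sub>s
      (\<Sum>\<gamma>\<in>?R. of_nat (?c \<gamma>) *\<^sub>s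
        (\<Sum>\<eta> | comp_compl \<alpha> \<preceq> \<eta>. (- 1) ^ (length \<eta> - 1) *\<^sub>s F_qsym (comp_join \<gamma> \<eta>)))) m"
    unfolding S_def .
qed

end
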